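(* Let $k$ and $n$ be positive integers with $n \leq (k+1)^2$. If $\mathcal{L}$ is a set of $k$-MOLS$(n)$, then $$c(G(\mathcal{L})) \geq \left\lceil \frac{n}{k+1}\right\rceil.$$
   Context: A latin square of order $n$ is an $n\times n$ array with entries from a set of $n$ symbols (taken to be $[n]=\{1,\dots,n\}$) such that each symbol occurs exactly once in each row and in each column. Two latin squares $A,B$ of order $n$ are orthogonal if the $n^2$ pairs $(A[i,j],B[i,j])$ are distinct. A set of $k$-MOLS$(n)$ is a set of $k$ pairwise orthogonal latin squares of order $n$ (for $k=1$, a single latin square). The latin square graph $G(\mathcal{L})$ of a set $\mathcal{L}$ of $k$-MOLS$(n)$ is the graph whose $n^2$ vertices are the cells $(i,j)\in[n]\times[n]$, where two distinct cells are adjacent if they share a row, share a column, or contain the same symbol in at least one of the $k$ latin squares. Cops and Robbers on a graph $G$: first the cops choose vertices, then the robber chooses a vertex; thereafter the cops and the robber alternate turns, and on a turn each player moves to an adjacent vertex or stays put. All positions are visible to everyone. The cops win if after finitely many rounds some cop lands on the robber's vertex; otherwise the robber wins. The cop number $c(G)$ is the least number of cops for which the cops have a winning strategy. *)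

theory Defs
  imports Complex_Main "HOL-Library.FuncSet" "Graph_Theory.Pair_Digraph"
begin

definition latin_square :: "nat \<Rightarrow> (nat \<Rightarrow> nat \<Rightarrow> nat) \<Rightarrow> bool" where
  "latin_square n A \<longleftrightarrow>
     A \<in> {1..n} \<rightarrow>\<^sub>E {1..n} \<rightarrow>\<^sub>E {1..n} \<and>
     (\<forall>i\<in>{1..n}. \<forall>s\<in>{1..n}. \<exists>!j. j \<in> {1..n} \<and> A i j = s) \<and>
     (\<forall>j\<in>{1..n}. \<forall>s\<in>{1..n}. \<exists>!i. i \<in> {1..n} \<and> A i j = s)"

definition orthogonal_squares ::
    "nat \<Rightarrow> (nat \<Rightarrow> nat \<Rightarrow> nat) \<Rightarrow> (nat \<Rightarrow> nat \<Rightarrow> nat) \<Rightarrow> bool" where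
  "orthogonal_squares n A B \<longleftrightarrow> inj_on (\<lambda>(i, j). (A i j, B i j)) ({1..n} \<times> {1..n})"

definition mols :: "nat \<Rightarrow> nat \<Rightarrow> (nat \<Rightarrow> nat \<Rightarrow> nat) set \<Rightarrow> bool" where
  "mols k n L \<longleftrightarrow>
     finite L \<and> card L = k \<and> (\<forall>A\<in>L. latin_square n A) \<and> pairwise (orthogonal_squares n) L"

text \<open>As usual for \<^locale>\<open>pair_graph\<close>, an undirected edge is a pair of opposite arcs.\<close>

definition latin_square_graph ::
    "nat \<Rightarrow> (nat \<Rightarrow> nat \<Rightarrow> nat) set \<Rightarrow> (nat \<times> nat) pair_pre_digraph" where
  "latin_square_graph n L =
     \<lparr> pverts = {1..n} \<times> {1..n},
       parcs = {((i, j), (i', j')) | i j i' j'.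
         (i, j) \<in> {1..n} \<times> {1..n} \<and> (i', j') \<in> {1..n} \<times> {1..n} \<and> (i, j) \<noteq> (i', j') \<and>
         (i = i' \<or> j = j' \<or> (\<exists>A\<in>L. A i j = A i' j'))} \<rparr>"

lemma pair_graph_latin_square_graph: "pair_graph (latin_square_graph n L)"
proof -
  let ?G = "latin_square_graph n L"
  have arc_iff: "(u, v) \<in> parcs ?G \<longleftrightarrow>
      u \<in> pverts ?G \<and> v \<in> pverts ?G \<and> u \<noteq> v \<and>
      (fst u = fst v \<or> snd u = snd v \<or> (\<exists>A\<in>L. A (fst u) (snd u) = A (fst v) (snd v)))" for u v
    by (cases u; cases v) (simp add: latin_square_graph_def)
  have wf: "fst e \<in> pverts ?G" "snd e \<in> pverts ?G" "fst e \<noteq> snd e" if "e \<in> parcs ?G" for e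
    using that arc_iff[of "fst e" "snd e"] by simp_all
  have fin: "finite (pverts ?G)"
    by (simp add: latin_square_graph_def)
  have "parcs ?G \<subseteq> pverts ?G \<times> pverts ?G"
    using wf by (metis mem_Times_iff subsetI)
  then have fin_arcs: "finite (parcs ?G)"
    using fin finite_subset by blast
  have "(v, u) \<in> parcs ?G" if "(u, v) \<in> parcs ?G" for u v
    using that unfolding arc_iff by metis
  then have "symmetric ?G"
    unfolding symmetric_def by (simp add: symI)
  then show ?thesis
    using wf fin fin_arcs by unfold_locales
qed

definition legal_move :: "'a pair_pre_digraph \<Rightarrow> 'a \<Rightarrow> 'a \<Rightarrow> bool" where
  "legal_move G u v \<longleftrightarrow> u \<in> pverts G \<and> v \<in> pverts G \<and> (u = v \<or> (u, v) \<in> parcs G)"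

definition robber_walk :: "'a pair_pre_digraph \<Rightarrow> (nat \<Rightarrow> 'a) \<Rightarrow> bool" where
  "robber_walk G r \<longleftrightarrow> (\<forall>t. legal_move G (r t) (r (Suc t)))"

text \<open>
  A strategy for \<open>m\<close> cops maps the list of robber positions seen so far to the list of
  cop positions: the empty history gives the initial placement, which precedes that of the
  robber. The earlier cop positions need not be part of the history, since they are
  determined by the strategy and the earlier robber positions.
\<close>

type_synonym 'a cop_strategy = "'a list \<Rightarrow> 'a list"

text \<open>
  The cops' positions after \<open>t\<close> cop moves, when the robber chooses the vertices
  \<open>r 0, r 1, \<dots>\<close>: the order of play is \<open>cops 0, r 0, cops 1, r 1, \<dots>\<close>.
\<close>

definition cop_positions :: "'a cop_strategy \<Rightarrow> (nat \<Rightarrow> 'a) \<Rightarrow> nat \<Rightarrow> 'a list" where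
  "cop_positions \<sigma> r t = \<sigma> (map r [0..<t])"

definition legal_cop_strategy :: "'a pair_pre_digraph \<Rightarrow> nat \<Rightarrow> 'a cop_strategy \<Rightarrow> bool" where
  "legal_cop_strategy G m \<sigma> \<longleftrightarrow>
     length (\<sigma> []) = m \<and> set (\<sigma> []) \<subseteq> pverts G \<and>
     (\<forall>r t. robber_walk G r \<longrightarrow>
        list_all2 (legal_move G) (cop_positions \<sigma> r t) (cop_positions \<sigma> r (Suc t)))"

text \<open>
  The robber is caught when a cop moves onto his vertex, or when he moves onto the vertex of
  a cop. Play is continued formally after a capture, which is harmless. A strategy is winning
  if it catches every robber; as it is fixed in advance, quantifying over all robber walks
  covers all, possibly adaptive, robber strategies.
\<close>

definition captured :: "'a cop_strategy \<Rightarrow> (nat \<Rightarrow> 'a) \<Rightarrow> nat \<Rightarrow> bool" where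
  "captured \<sigma> r t \<longleftrightarrow>
     r t \<in> set (cop_positions \<sigma> r t) \<or> r t \<in> set (cop_positions \<sigma> r (Suc t))"

definition winning_cop_strategy :: "'a pair_pre_digraph \<Rightarrow> nat \<Rightarrow> 'a cop_strategy \<Rightarrow> bool" where
  "winning_cop_strategy G m \<sigma> \<longleftrightarrow>
     legal_cop_strategy G m \<sigma> \<and> (\<forall>r. robber_walk G r \<longrightarrow> (\<exists>t. captured \<sigma> r t))"

definition cops_win :: "'a pair_pre_digraph \<Rightarrow> nat \<Rightarrow> bool" where
  "cops_win G m \<longleftrightarrow> (\<exists>\<sigma>. winning_cop_strategy G m \<sigma>)"

definition cop_number :: "'a pair_pre_digraph \<Rightarrow> nat" where
  "cop_number G = (LEAST m. cops_win G m)"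

text \<open>On a finite graph the minimum is attained, so \<^const>\<open>cop_number\<close> is meaningful.\<close>

lemma cops_win_card_verts:
  assumes "finite (pverts G)"
  shows "cops_win G (card (pverts G))"
proof -
  obtain vs where vs: "set vs = pverts G" and dist: "distinct vs"
    using finite_distinct_list[OF assms] by (elim exE conjE)
  have len: "length vs = card (pverts G)"
    by (simp only: vs[symmetric] distinct_card[OF dist])
  have "list_all2 (legal_move G) vs vs"
    by (rule list.rel_refl_strong) (simp add: vs legal_move_def)
  then have legal: "legal_cop_strategy G (card (pverts G)) (\<lambda>_. vs)"
    by (simp only: legal_cop_strategy_def cop_positions_def vs len simp_thms order_refl)
  have "captured (\<lambda>_. vs) r 0" if "robber_walk G r" for r
    using that by (simp only: robber_walk_def legal_move_def captured_def cop_positions_def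
        vs simp_thms)
  then have "winning_cop_strategy G (card (pverts G)) (\<lambda>_. vs)"
    unfolding winning_cop_strategy_def using legal by (intro conjI allI impI exI) assumption+
  then show ?thesis
    unfolding cops_win_def by (rule exI[where P = "winning_cop_strategy G (card (pverts G))"])
qed

lemma cops_win_cop_number:
  assumes "finite (pverts G)"
  shows "cops_win G (cop_number G)"
  unfolding cop_number_def by (rule LeastI) (rule cops_win_card_verts[OF assms])

end

(* The k + 2 parallel classes of the net (rows, columns, symbols of each square) give k + 2 lines
   through every point. With m cops and m (k + 1) < n \<le> (k + 1)^2 we have m \<le> k, so some line
   through the robber contains no cop. On it each cop threatens at most k + 1 of the n points,
   namely where the lines of the other k + 1 classes through that cop meet it. As m (k + 1) < n,
   the robber always has a safe point to move to. *)

theory Submission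
  imports Defs
begin

section \<open>Evading the cops\<close>

text \<open>Course-of-values recursion: a cop strategy reads the whole list of earlier robber
  positions. Recursing on the list \<open>S t\<close> of the first \<open>t + 1\<close> values makes
  it primitive recursion.\<close>

lemma ex_history_recursion:
  fixes a :: 'a and g :: "'a list \<Rightarrow> 'a"
  shows "\<exists>r. r 0 = a \<and> (\<forall>t. r (Suc t) = g (map r [0..<Suc t]))"
proof -
  define S where "S = rec_nat [a] (\<lambda>_ xs. xs @ [g xs])"
  define r where "r = (\<lambda>t. last (S t))"
  have S: "S 0 = [a]" "\<And>t. S (Suc t) = S t @ [g (S t)]"
    by (simp_all add: S_def)
  have "S t = map r [0..<Suc t]" for t
    by (induction t) (simp_all add: S r_def)
  then have "r (Suc t) = g (map r [0..<Suc t])" for t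
    using S(2)[of t] by (metis last_snoc r_def)
  moreover have "r 0 = a"
    by (simp add: r_def S)
  ultimately show ?thesis
    by blast
qed

lemma cop_positions_legal:
  assumes legal: "legal_cop_strategy G m \<sigma>" and walk: "robber_walk G r"
  shows "length (cop_positions \<sigma> r t) = m \<and> set (cop_positions \<sigma> r t) \<subseteq> pverts G"
proof (induction t)
  case 0
  then show ?case
    using legal by (simp add: legal_cop_strategy_def cop_positions_def)
next
  case (Suc t)
  have "list_all2 (legal_move G) (cop_positions \<sigma> r t) (cop_positions \<sigma> r (Suc t))"
    using legal walk unfolding legal_cop_strategy_def by blast
  then show ?case
    using Suc by (auto simp: list_all2_conv_all_nth legal_move_def in_set_conv_nth)
qed

text \<open>After each of his moves the robber is out of reach of every cop. The next cop move then
  cannot land on him, so he stands on a free vertex and \<open>escape\<close> restores the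
  invariant.\<close>

lemma not_cops_win_if_escape:
  assumes start: "\<And>C. length C = m \<Longrightarrow> set C \<subseteq> pverts G \<Longrightarrow> \<exists>v\<in>pverts G. v \<notin> set C"
    and escape: "\<And>v C. v \<in> pverts G \<Longrightarrow> length C = m \<Longrightarrow> set C \<subseteq> pverts G \<Longrightarrow> v \<notin> set C \<Longrightarrow>
      \<exists>w. legal_move G v w \<and> (\<forall>c\<in>set C. \<not> legal_move G c w)"
  shows "\<not> cops_win G m"
proof
  assume "cops_win G m"
  then obtain \<sigma> where legal: "legal_cop_strategy G m \<sigma>"
    and catch: "\<And>r. robber_walk G r \<Longrightarrow> \<exists>t. captured \<sigma> r t"
    unfolding cops_win_def winning_cop_strategy_def by blast
  define safe where "safe v C w \<longleftrightarrow> legal_move G v w \<and> (\<forall>c\<in>set C. \<not> legal_move G c w)" for v C w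
  \<comment> \<open>The default \<open>v\<close> makes \<open>step\<close> a legal move for every
    \<open>C\<close>. This matters because \<open>legal\<close> constrains the cops only along
    robber walks, so \<open>r\<close> must be a walk before anything is known about the cop
    positions.\<close>
  define step where "step v C = (if \<exists>w. safe v C w then SOME w. safe v C w else v)" for v C
  have step_safe: "safe v C (step v C)"
    if "v \<in> pverts G" "length C = m" "set C \<subseteq> pverts G" "v \<notin> set C" for v C
    using escape[OF that] unfolding step_def safe_def[symmetric] by (simp add: someI_ex)
  have step_legal: "legal_move G v (step v C)" if "v \<in> pverts G" for v C
  proof (cases "\<exists>w. safe v C w")
    case True
    then have "safe v C (step v C)"
      by (simp add: step_def someI_ex)
    then show ?thesis
      by (simp add: safe_def)
  next
    case False
    then show ?thesis
      using that by (simp add: step_def legal_move_def)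
  qed
  have init: "length (\<sigma> []) = m" "set (\<sigma> []) \<subseteq> pverts G"
    using legal by (auto simp: legal_cop_strategy_def)
  obtain v where v: "v \<in> pverts G" "v \<notin> set (\<sigma> [])"
    using start init by blast
  \<comment> \<open>The vertex \<open>v\<close> is free but possibly adjacent to a cop. The robber
    therefore starts where he would flee to from \<open>v\<close>, so that the invariant holds from
    the beginning.\<close>
  obtain r where r0: "r 0 = step v (\<sigma> [])"
    and r_rec: "\<And>t. r (Suc t) = step (last (map r [0..<Suc t])) (\<sigma> (map r [0..<Suc t]))"
    using ex_history_recursion[of "step v (\<sigma> [])" "\<lambda>h. step (last h) (\<sigma> h)"] by auto
  \<comment> \<open>No circularity: the cop positions at time \<open>Suc t\<close> depend only on
    \<open>r 0\<close>, ..., \<open>r t\<close>.\<close>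
  have r_Suc: "r (Suc t) = step (r t) (cop_positions \<sigma> r (Suc t))" for t
    using r_rec[of t] by (simp add: cop_positions_def)
  have r_in: "r t \<in> pverts G" for t
  proof (induction t)
    case 0
    then show ?case
      using step_legal[OF v(1)] by (simp add: r0 legal_move_def)
  next
    case (Suc t)
    then show ?case
      using step_legal[OF Suc] by (simp add: r_Suc legal_move_def)
  qed
  have walk: "robber_walk G r"
    unfolding robber_walk_def using step_legal[OF r_in] by (simp add: r_Suc)
  note pos = cop_positions_legal[OF legal walk]
  have moves: "list_all2 (legal_move G) (cop_positions \<sigma> r t) (cop_positions \<sigma> r (Suc t))" for t
    using legal walk unfolding legal_cop_strategy_def by blast
  have not_next: "r t \<notin> set (cop_positions \<sigma> r (Suc t))"
    if "\<forall>c\<in>set (cop_positions \<sigma> r t). \<not> legal_move G c (r t)" for t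
    using that moves[of t] by (metis in_set_conv_nth list_all2_conv_all_nth)
  have unthreatened: "\<forall>c\<in>set (cop_positions \<sigma> r t). \<not> legal_move G c (r t)" for t
  proof (induction t)
    case 0
    then show ?case
      using step_safe[OF v(1) init v(2)] by (simp add: r0 safe_def cop_positions_def)
  next
    case (Suc t)
    then show ?case
      using step_safe[OF r_in _ _ not_next[OF Suc]] pos[of "Suc t"]
      by (simp add: r_Suc[symmetric] safe_def)
  qed
  \<comment> \<open>Staying put is a legal move, so a cop on \<open>r t\<close> would threaten
    it.\<close>
  have "r t \<notin> set (cop_positions \<sigma> r t)" for t
    using unthreatened[of t] r_in[of t] by (auto simp: legal_move_def)
  then have "\<not> captured \<sigma> r t" for t
    using not_next[OF unthreatened] by (simp add: captured_def)
  then show False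
    using catch[OF walk] by blast
qed

section \<open>Nets\<close>

text \<open>
  The level sets of \<open>f i\<close> are the lines of the parallel class \<open>i\<close>. The classes are kept as an
  index set, since for \<open>n = 1\<close> all the functions \<open>f i\<close> agree on the only point.
\<close>

locale net =
  fixes n :: nat and P :: "'p set" and I :: "'i set" and f :: "'i \<Rightarrow> 'p \<Rightarrow> nat"
  assumes finite_P: "finite P" and card_P: "card P = n * n"
    and finite_I: "finite I" and card_I: "card I \<ge> 2"
    and f_in: "i \<in> I \<Longrightarrow> p \<in> P \<Longrightarrow> f i p \<in> {1..n}"
    and f_inj: "i \<in> I \<Longrightarrow> j \<in> I \<Longrightarrow> i \<noteq> j \<Longrightarrow> p \<in> P \<Longrightarrow> q \<in> P \<Longrightarrow>
      f i p = f i q \<Longrightarrow> f j p = f j q \<Longrightarrow> p = q"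
begin

text \<open>With a second class \<open>j\<close>, the coordinates \<open>(f i p, f j p)\<close>
  embed the \<open>n * n\<close> points into an \<open>n\<close> by \<open>n\<close> grid, hence
  biject onto it. A line of class \<open>i\<close> corresponds to a set
  \<open>{a} \<times> {1..n}\<close>.\<close>

lemma card_line:
  assumes i: "i \<in> I" and a: "a \<in> {1..n}"
  shows "card {p \<in> P. f i p = a} = n"
proof -
  have "\<not> I \<subseteq> {i}"
    using card_I card_mono[of "{i}" I] by auto
  then obtain j where j: "j \<in> I" "i \<noteq> j"
    by blast
  let ?g = "\<lambda>p. (f i p, f j p)"
  have inj: "inj_on ?g P"
    using f_inj[OF i j] by (auto intro!: inj_onI)
  have "?g ` P = {1..n} \<times> {1..n}"
  proof (rule card_subset_eq)
    show "?g ` P \<subseteq> {1..n} \<times> {1..n}"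
      using f_in i j by blast
    show "card (?g ` P) = card ({1..n} \<times> {1..n})"
      by (simp add: card_image[OF inj] card_P)
  qed simp
  moreover have "?g ` {p \<in> P. f i p = a} = ?g ` P \<inter> {a} \<times> UNIV"
    by blast
  ultimately have "?g ` {p \<in> P. f i p = a} = {a} \<times> {1..n}"
    using a by auto
  moreover have "inj_on ?g {p \<in> P. f i p = a}"
    using inj by (rule inj_on_subset) auto
  ultimately have "card {p \<in> P. f i p = a} = card ({a} \<times> {1..n})"
    by (simp only: card_image[symmetric])
  then show ?thesis
    by (simp add: card_cartesian_product)
qed

text \<open>Pigeonhole: lines of different classes through \<open>v\<close> meet only in
  \<open>v\<close>, which is not in \<open>C\<close>. If each of them met \<open>C\<close>, the
  chosen points \<open>h i\<close> would be distinct and \<open>C\<close> would have at least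
  \<open>card I\<close> elements.\<close>

lemma ex_line_avoiding:
  assumes v: "v \<in> P" and C: "finite C" "C \<subseteq> P" "v \<notin> C" and small: "card C < card I"
  shows "\<exists>i\<in>I. \<forall>c\<in>C. f i c \<noteq> f i v"
proof (rule ccontr)
  assume "\<not> ?thesis"
  then have "\<forall>i\<in>I. \<exists>c. c \<in> C \<and> f i c = f i v"
    by blast
  then obtain h where h: "\<And>i. i \<in> I \<Longrightarrow> h i \<in> C \<and> f i (h i) = f i v"
    by metis
  have "inj_on h I"
  proof (rule inj_onI, rule ccontr)
    fix i j assume "i \<in> I" "j \<in> I" "h i = h j" "i \<noteq> j"
    then have "h i = v"
      using f_inj[of i j "h i" v] h[of i] h[of j] v C by auto
    then show False
      using h[OF \<open>i \<in> I\<close>] C by simp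
  qed
  moreover have "h ` I \<subseteq> C"
    using h by blast
  ultimately show False
    using card_inj_on_le[OF _ _ C(1)] small by force
qed

lemma ex_escape:
  assumes v: "v \<in> P" and C: "finite C" "C \<subseteq> P" "v \<notin> C" and small: "card C < card I"
    and few: "card C * (card I - 1) < n"
  shows "\<exists>i\<in>I. \<exists>p\<in>P. f i p = f i v \<and> (\<forall>c\<in>C. \<forall>j\<in>I. f j c \<noteq> f j p)"
proof -
  obtain i where i: "i \<in> I" and free: "\<forall>c\<in>C. f i c \<noteq> f i v"
    using ex_line_avoiding[OF v C small] by blast
  define l where "l = {p \<in> P. f i p = f i v}"
  \<comment> \<open>The threatened points of the free line \<open>l\<close>. Class \<open>i\<close>
    is left out because no point of \<open>C\<close> lies on \<open>l\<close>.\<close>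
  define T where "T = (\<Union>(c, j)\<in>C \<times> (I - {i}). {p \<in> l. f j p = f j c})"
  \<comment> \<open>Points of \<open>l\<close> already agree in class \<open>i\<close>, so agreeing
    in class \<open>j\<close> as well makes them equal.\<close>
  have "card {p \<in> l. f j p = f j c} \<le> 1" if "j \<in> I - {i}" for c j
    using that finite_P f_inj[OF i, of j] by (auto simp: l_def card_le_Suc0_iff_eq)
  then have "card T \<le> (\<Sum>x\<in>C \<times> (I - {i}). 1)"
    unfolding T_def using C(1) finite_I
    by (intro order_trans[OF card_UN_le] sum_mono) auto
  also have "\<dots> = card C * (card I - 1)"
    using i finite_I by (simp add: card_cartesian_product)
  also have "\<dots> < card l"
    using few card_line[OF i f_in[OF i v]] by (simp add: l_def)
  finally have "card T < card l" .
  moreover have "finite T"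
    using C(1) finite_I finite_P by (auto simp: T_def l_def)
  ultimately obtain p where p: "p \<in> l" "p \<notin> T"
    by (meson card_mono not_le subsetI)
  have "f j c \<noteq> f j p" if "c \<in> C" "j \<in> I" for c j
  proof (cases "j = i")
    case True
    then show ?thesis
      using that p(1) free by (simp add: l_def)
  next
    case False
    then have "p \<in> T" if "f j p = f j c"
      unfolding T_def using that p(1) \<open>c \<in> C\<close> \<open>j \<in> I\<close> by blast
    then show ?thesis
      using p(2) by metis
  qed
  then show ?thesis
    using p i unfolding l_def by blast
qed

end

section \<open>The net of a set of MOLS\<close>

text \<open>The booleans index the rows (\<open>True\<close>) and the columns
  (\<open>False\<close>). The sum type keeps these classes apart from each other and from the
  squares, which gives the count \<open>k + 2\<close>.\<close>

definition mols_classes ::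
    "(nat \<Rightarrow> nat \<Rightarrow> nat) set \<Rightarrow> (bool + (nat \<Rightarrow> nat \<Rightarrow> nat)) set" where
  "mols_classes L = UNIV <+> L"

definition mols_coord :: "bool + (nat \<Rightarrow> nat \<Rightarrow> nat) \<Rightarrow> nat \<times> nat \<Rightarrow> nat" where
  "mols_coord s p =
     (case s of Inl b \<Rightarrow> (if b then fst p else snd p) | Inr A \<Rightarrow> A (fst p) (snd p))"

lemma card_mols_classes:
  assumes "mols k n L"
  shows "card (mols_classes L) = k + 2"
  using assms by (simp add: mols_def mols_classes_def card_Plus)

text \<open>Two lines of different classes meet at most once: a row and a column trivially, a row or
  column and a symbol class by the latin property, symbol classes of two squares by
  orthogonality.\<close>

lemma net_mols:
  assumes mols: "mols k n L"
  shows "net n ({1..n} \<times> {1..n}) (mols_classes L) mols_coord"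
proof
  have latin: "latin_square n A" if "A \<in> L" for A
    using mols that by (simp add: mols_def)
  show "finite (mols_classes L)" "2 \<le> card (mols_classes L)"
    using mols card_mols_classes[OF mols] by (simp_all add: mols_classes_def mols_def)
  have A_in: "A i j \<in> {1..n}" if "A \<in> L" "i \<in> {1..n}" "j \<in> {1..n}" for A i j
    using latin[OF that(1)] that(2,3) unfolding latin_square_def by (meson PiE_mem)
  show "mols_coord s p \<in> {1..n}" if "s \<in> mols_classes L" "p \<in> {1..n} \<times> {1..n}" for s p
  proof (cases s)
    case (Inl b)
    then show ?thesis
      using that(2) by (auto simp: mols_coord_def)
  next
    case (Inr A)
    then show ?thesis
      using that A_in[of A "fst p" "snd p"] by (auto simp: mols_classes_def mols_coord_def)
  qed
  have row: "j = j'" if "A \<in> L" "i \<in> {1..n}" "j \<in> {1..n}" "j' \<in> {1..n}" "A i j = A i j'"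
    for A i j j'
  proof -
    have "\<forall>s\<in>{1..n}. \<exists>!x. x \<in> {1..n} \<and> A i x = s"
      using latin[OF that(1), unfolded latin_square_def, THEN conjunct2, THEN conjunct1] that(2)
      by (rule bspec)
    then have "\<exists>!x. x \<in> {1..n} \<and> A i x = A i j"
      using A_in[OF that(1-3)] by (rule bspec)
    then show ?thesis
      using that(3-5) by metis
  qed
  have col: "i = i'" if "A \<in> L" "i \<in> {1..n}" "i' \<in> {1..n}" "j \<in> {1..n}" "A i j = A i' j"
    for A i i' j
  proof -
    have "\<forall>s\<in>{1..n}. \<exists>!x. x \<in> {1..n} \<and> A x j = s"
      using latin[OF that(1), unfolded latin_square_def, THEN conjunct2, THEN conjunct2] that(4)
      by (rule bspec)
    then have "\<exists>!x. x \<in> {1..n} \<and> A x j = A i j"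
      using A_in[OF that(1,2,4)] by (rule bspec)
    then show ?thesis
      using that(2,3,5) by metis
  qed
  have orth: "p = q" if "A \<in> L" "B \<in> L" "A \<noteq> B" "p \<in> {1..n} \<times> {1..n}" "q \<in> {1..n} \<times> {1..n}"
    "A (fst p) (snd p) = A (fst q) (snd q)" "B (fst p) (snd p) = B (fst q) (snd q)" for A B p q
  proof -
    have "inj_on (\<lambda>(i, j). (A i j, B i j)) ({1..n} \<times> {1..n})"
      using mols that(1-3) by (auto simp: mols_def pairwise_def orthogonal_squares_def)
    then show ?thesis
      by (rule inj_onD) (use that in \<open>auto simp: split_beta\<close>)
  qed
  show "p = q"
    if st: "s \<in> mols_classes L" "t \<in> mols_classes L" "s \<noteq> t"
      and pq: "p \<in> {1..n} \<times> {1..n}" "q \<in> {1..n} \<times> {1..n}"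
      and eq: "mols_coord s p = mols_coord s q" "mols_coord t p = mols_coord t q" for s t p q
  proof -
    have swap: "p = q" if "A \<in> L" "mols_coord (Inl b) p = mols_coord (Inl b) q"
      "mols_coord (Inr A) p = mols_coord (Inr A) q" for A b
    proof -
      obtain i j i' j' where [simp]: "p = (i, j)" "q = (i', j')"
        by (cases p, cases q)
      show ?thesis
      proof (cases b)
        case True
        then show ?thesis
          using that pq row[OF that(1), of i j j'] by (simp add: mols_coord_def)
      next
        case False
        then show ?thesis
          using that pq col[OF that(1), of i i' j] by (simp add: mols_coord_def)
      qed
    qed
    show ?thesis
    proof (cases s; cases t)
      fix b c assume "s = Inl b" "t = Inl c"
      then show ?thesis
        using st(3) eq by (cases b; cases c) (auto simp: mols_coord_def prod_eq_iff)
    next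
      fix A B assume "s = Inr A" "t = Inr B"
      then show ?thesis
        using st pq eq orth[of A B p q] by (simp add: mols_classes_def mols_coord_def Plus_def image_iff)
    next
      fix b A assume "s = Inl b" "t = Inr A"
      then show ?thesis
        using swap[of A b] st(2) eq by (auto simp: mols_classes_def)
    next
      fix A b assume "s = Inr A" "t = Inl b"
      then show ?thesis
        using swap[of A b] st(1) eq by (auto simp: mols_classes_def)
    qed
  qed
qed (simp_all add: card_cartesian_product)

text \<open>Arcs exclude loops, but staying put is legal and a cell shares all its lines with
  itself. Hence moving means exactly staying on a common line.\<close>

lemma legal_move_latin_square_graph_iff:
  "legal_move (latin_square_graph n L) p q \<longleftrightarrow>
     p \<in> {1..n} \<times> {1..n} \<and> q \<in> {1..n} \<times> {1..n} \<and>
     (\<exists>s\<in>mols_classes L. mols_coord s p = mols_coord s q)"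
proof -
  have "(\<exists>s\<in>mols_classes L. mols_coord s p = mols_coord s q) \<longleftrightarrow>
      fst p = fst q \<or> snd p = snd q \<or> (\<exists>A\<in>L. A (fst p) (snd p) = A (fst q) (snd q))"
    by (auto simp: mols_classes_def mols_coord_def Plus_def bex_Un UNIV_bool)
  then show ?thesis
    by (cases p; cases q) (auto simp: legal_move_def latin_square_graph_def)
qed

lemma not_cops_win_latin_square_graph:
  assumes mols: "mols k n L" and few: "m * (k + 1) < n" and small: "m < k + 2"
  shows "\<not> cops_win (latin_square_graph n L) m"
proof (rule not_cops_win_if_escape)
  interpret net n "{1..n} \<times> {1..n}" "mols_classes L" mols_coord
    using mols by (rule net_mols)
  have verts: "pverts (latin_square_graph n L) = {1..n} \<times> {1..n}"
    by (simp add: latin_square_graph_def)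
  fix C assume len: "length C = m" and C: "set C \<subseteq> pverts (latin_square_graph n L)"
  \<comment> \<open>Several cops may share a vertex, so only an inequality holds; both bounds on
    \<open>m\<close> pass down to \<open>card (set C)\<close>.\<close>
  have card_C: "card (set C) \<le> m"
    using card_length[of C] len by simp
  have "m < n"
    using few by (simp add: add_lessD1)
  also have "n \<le> n * n"
    by (rule le_square)
  finally have "card (set C) < card ({1..n} \<times> {1..n})"
    using card_C by (simp add: card_P)
  then show "\<exists>v\<in>pverts (latin_square_graph n L). v \<notin> set C"
    unfolding verts by (meson List.finite_set card_mono not_le subsetI)
  fix v assume v: "v \<in> pverts (latin_square_graph n L)" "v \<notin> set C"
  have "card (set C) * (k + 1) < n"
    using mult_le_mono1[OF card_C, of "k + 1"] few by linarith
  then have "\<exists>s\<in>mols_classes L. \<exists>w\<in>{1..n} \<times> {1..n}. mols_coord s w = mols_coord s v \<and>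
      (\<forall>c\<in>set C. \<forall>t\<in>mols_classes L. mols_coord t c \<noteq> mols_coord t w)"
  proof (intro ex_escape)
    show "v \<in> {1..n} \<times> {1..n}" "set C \<subseteq> {1..n} \<times> {1..n}" "v \<notin> set C"
      using v C by (simp_all only: verts not_False_eq_True)
    show "card (set C) < card (mols_classes L)"
      using card_C small by (simp only: card_mols_classes[OF mols])
  qed (simp_all add: card_mols_classes[OF mols])
  then obtain s w where s: "s \<in> mols_classes L" and w: "w \<in> {1..n} \<times> {1..n}"
    and vw: "mols_coord s w = mols_coord s v"
    and unthreatened: "\<forall>c\<in>set C. \<forall>t\<in>mols_classes L. mols_coord t c \<noteq> mols_coord t w"
    by (elim bexE conjE)
  have "legal_move (latin_square_graph n L) v w"
    unfolding legal_move_latin_square_graph_iff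
    using s w vw[symmetric] v(1)[unfolded verts] by (intro conjI bexI[of _ s])
  moreover have "\<not> legal_move (latin_square_graph n L) c w" if "c \<in> set C" for c
    using bspec[OF unthreatened that] by (simp only: legal_move_latin_square_graph_iff) simp
  ultimately show "\<exists>w. legal_move (latin_square_graph n L) v w \<and>
      (\<forall>c\<in>set C. \<not> legal_move (latin_square_graph n L) c w)"
    by (intro exI[of _ w] conjI ballI)
qed

theorem theorem2p4:
  fixes k n :: nat and L :: "(nat \<Rightarrow> nat \<Rightarrow> nat) set"
  assumes "k \<ge> 1" and "n \<ge> 1" and "n \<le> (k + 1)\<^sup>2"
    and "mols k n L"
  shows "int (cop_number (latin_square_graph n L)) \<ge> \<lceil>real n / real (k + 1)\<rceil>"
proof -
  let ?m = "cop_number (latin_square_graph n L)"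
  have "finite (pverts (latin_square_graph n L))"
    by (simp add: latin_square_graph_def)
  then have win: "cops_win (latin_square_graph n L) ?m"
    by (rule cops_win_cop_number)
  \<comment> \<open>Since \<open>?m\<close> is an integer, this is the claim about the ceiling
    without division.\<close>
  have "n \<le> ?m * (k + 1)"
  proof (rule ccontr)
    assume "\<not> n \<le> ?m * (k + 1)"
    then have few: "?m * (k + 1) < n"
      by simp
    \<comment> \<open>Here \<open>n \<le> (k + 1)\<^sup>2\<close> turns \<open>few\<close> into a
      bound on the cops alone: there are fewer of them than the \<open>k + 2\<close> lines through a
      cell.\<close>
    also have "\<dots> \<le> (k + 1) * (k + 1)"
      using assms(3) by (simp only: power2_eq_square)
    finally have "?m < k + 1"
      using mult_less_cancel2 by blast
    then show False
      using not_cops_win_latin_square_graph[OF assms(4) few] win by simp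
  qed
  then have "real n \<le> real ?m * real (k + 1)"
    by (simp only: of_nat_mult[symmetric] of_nat_le_iff)
  then have "real n / real (k + 1) \<le> real ?m"
    by (subst pos_divide_le_eq) simp_all
  then show ?thesis
    by (simp only: ceiling_le_iff of_int_of_nat_eq)
qed

end
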